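(* Let $r\in(0,\infty)$ and $R\in[r,\infty]$ satisfy $$r^2+\frac{4r}{R}>4,$$ and let $f\in\mathrm{Cvx}_0(\mathbb{R}^d)$ satisfy $\frac r2\|x\|^2\le f(x)\le\frac R2\|x\|^2$ for all $x\in\mathbb{R}^d$. Then the continued fraction $z_n=[\underbrace{f,\dots,f}_{n}]$ with constant term $f$ converges in the metric $\rho_h$ to some $z\in\mathbb{K}_h$ satisfying $z^*=z+f$.
   Context: $\mathrm{Cvx}_0(\mathbb{R}^d)$ is the set of lower semicontinuous convex functions $f:\mathbb{R}^d\to[0,\infty]$ with $f(0)=0$, with pointwise addition and pointwise order. $f^*$ is the Legendre--Fenchel transform, $f^*(x)=\sup_{y\in\mathbb{R}^d}(\langle x,y\rangle-f(y))$. Approximants are defined by $[f_1]=f_1^*$ and $[f_1,\dots,f_{n+1}]=(f_1+[f_2,\dots,f_{n+1}])^*$, $n\ge1$. Let $h(x)=\frac12\|x\|^2$ (Euclidean norm). $\mathbb{K}_h$ is the set of $f\in\mathrm{Cvx}_0(\mathbb{R}^d)$ such that $f\le ah$ for some $a>0$, and $$\rho_h(f,g)=\inf\{\varepsilon>0: f(x)\le g(x)+\tfrac\varepsilon2\|x\|^2,\ g(x)\le f(x)+\tfrac\varepsilon2\|x\|^2\ \text{for all }x\in\mathbb{R}^d\}.$$ For $R=\infty$, the upper bound on $f$ is void and $4r/R=0$. *)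

theory Defs
  imports "HOL-Analysis.Analysis"
begin

text \<open>
  Functions with values in \<open>[0, \<infinity>]\<close> are rendered as \<^typ>\<open>ereal\<close>-valued functions that are
  pointwise nonnegative, so that the Legendre--Fenchel transform (whose supremum ranges over
  possibly negative terms) can be written literally.
\<close>

definition lower_semicontinuous :: "('a::topological_space \<Rightarrow> ereal) \<Rightarrow> bool" where
  "lower_semicontinuous f \<longleftrightarrow> (\<forall>x. f x \<le> Liminf (at x) f)"

text \<open>
  The library's \<^const>\<open>convex_on\<close> covers only real-valued functions. For \<open>f \<ge> 0\<close> the right-hand
  side below never has the form \<open>\<infinity> - \<infinity>\<close>; the endpoints \<open>t = 0, 1\<close> are left out because they
  carry no condition.
\<close>

definition convex_ereal :: "('a::real_vector \<Rightarrow> ereal) \<Rightarrow> bool" where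
  "convex_ereal f \<longleftrightarrow>
     (\<forall>x y t. 0 < t \<and> t < 1 \<longrightarrow>
        f ((1 - t) *\<^sub>R x + t *\<^sub>R y) \<le> ereal (1 - t) * f x + ereal t * f y)"

definition Cvx0 :: "('a::euclidean_space \<Rightarrow> ereal) set" where
  "Cvx0 = {f. (\<forall>x. 0 \<le> f x) \<and> f 0 = 0 \<and> convex_ereal f \<and> lower_semicontinuous f}"

definition fenchel :: "('a::euclidean_space \<Rightarrow> ereal) \<Rightarrow> 'a \<Rightarrow> ereal" where
  "fenchel f x = (SUP y. ereal (x \<bullet> y) - f y)"

text \<open>The approximant of the empty list is left unspecified.\<close>

fun approximant :: "('a::euclidean_space \<Rightarrow> ereal) list \<Rightarrow> 'a \<Rightarrow> ereal" where
  "approximant [f] = fenchel f"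
| "approximant (f # g # fs) = fenchel (\<lambda>x. f x + approximant (g # fs) x)"

definition half_sq :: "'a::euclidean_space \<Rightarrow> real" where
  "half_sq x = (norm x)\<^sup>2 / 2"

definition K_h :: "('a::euclidean_space \<Rightarrow> ereal) set" where
  "K_h = {f \<in> Cvx0. \<exists>a>0. \<forall>x. f x \<le> ereal (a * half_sq x)}"

text \<open>
  The infimum is that of a nonempty set when \<open>f\<close> and \<open>g\<close> belong to \<^term>\<open>K_h\<close>; outside
  \<^term>\<open>K_h\<close> the value has no meaning.
\<close>

definition rho_h :: "('a::euclidean_space \<Rightarrow> ereal) \<Rightarrow> ('a \<Rightarrow> ereal) \<Rightarrow> real" where
  "rho_h f g = Inf {\<epsilon>. \<epsilon> > 0 \<and>
     (\<forall>x. f x \<le> g x + ereal (\<epsilon> / 2 * (norm x)\<^sup>2) \<and> g x \<le> f x + ereal (\<epsilon> / 2 * (norm x)\<^sup>2))}"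

end

theory Submission
  imports Defs
begin

text \<open>
  Write \<open>h x = (norm x)\<^sup>2 / 2\<close> and \<open>T g = (f + g)\<^sup>*\<close>, where \<open>\<^sup>*\<close> is the Legendre--Fenchel transform.
  The approximants are the iterates \<open>z\<^sub>n = T\<^sup>n 0\<close>, so the theorem asks for convergence of an iteration
  to a fixed point of \<open>T\<close>. It is obtained from a contraction estimate in the metric \<open>\<rho>\<^sub>h\<close>.

  \<^emph>\<open>Contraction\<close> (\<open>fenchel_perturb\<close>). Let \<open>F \<ge> m h\<close> and \<open>F\<^sup>* \<ge> w h\<close>. In the supremum defining
  \<open>F\<^sup>* x\<close> a point \<open>y\<close> contributes at most \<open>norm x * norm y - m h y\<close>, so only those \<open>y\<close> matter for which
  this is at least \<open>w h x\<close>. For \<open>t = norm y / norm x\<close> this reads \<open>m t\<^sup>2 - 2 t + w \<le> 0\<close>, which bounds \<open>t\<close>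
  by some \<open>k\<close>. Adding \<open>\<epsilon> h\<close> to \<open>F\<close> therefore lowers \<open>F\<^sup>*\<close> by at most \<open>\<epsilon> k\<^sup>2 h\<close>. One can take \<open>k < 1\<close> if
  \<open>m > 1\<close> and the quadratic is positive at \<open>1\<close>, that is, \<open>m + w > 2\<close>. On functions \<open>g \<ge> w h\<close> with \<open>T g \<ge> w h\<close>
  one has \<open>m = r + w\<close>, and both conditions
  follow from \<open>r + 2 w > 2\<close> (\<open>contraction_factor\<close>).

  \<^emph>\<open>Reaching the contracting region\<close> (\<open>Z_eventually_ge\<close>). If \<open>R = \<infinity>\<close>, the hypothesis says
  \<open>r > 2\<close> and \<open>w = 0\<close> suffices. If \<open>R\<close> is finite, a bound \<open>z\<^sub>n \<ge> w h\<close> implies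
  \<open>z\<^sub>n\<^sub>+\<^sub>1 \<le> h / (r + w)\<close> and then \<open>z\<^sub>n\<^sub>+\<^sub>2 \<ge> w' h\<close> with \<open>w' = 1 / (R + 1 / (r + w))\<close>. The sign of
  \<open>w' - w\<close> is that of \<open>r / R - r w - w\<^sup>2 = r / R + r\<^sup>2 / 4 - (w + r / 2)\<^sup>2\<close>; while \<open>r + 2 w \<le> 2\<close> this is at
  least \<open>r / R + r\<^sup>2 / 4 - 1\<close>, which is positive precisely because \<open>r\<^sup>2 + 4 r / R > 4\<close>. So the lower bound
  grows by a fixed amount every two steps until \<open>r + 2 w > 2\<close>.

  \<^emph>\<open>Limit\<close> (\<open>Z_converges\<close>). The iterates are then uniformly Cauchy relative to \<open>h\<close>, their limit \<open>z\<close>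
  satisfies \<open>z = T z\<close>, and the Fenchel--Moreau theorem (\<open>fenchel_fenchel\<close>) turns
  \<open>z = (f + z)\<^sup>*\<close> into \<open>z\<^sup>* = f + z\<close>.
\<close>

section \<open>The Legendre--Fenchel transform\<close>

lemma fenchel_ge:
  assumes "F y \<le> ereal t"
  shows "ereal (x \<bullet> y - t) \<le> fenchel F x"
proof -
  have "ereal (x \<bullet> y - t) \<le> ereal (x \<bullet> y) - F y"
    using ereal_minus_mono[OF order_refl assms, of "ereal (x \<bullet> y)"] by simp
  also have "\<dots> \<le> fenchel F x"
    unfolding fenchel_def by (rule SUP_upper) simp
  finally show ?thesis .
qed

lemma fenchel_le:
  assumes "\<And>y. 0 \<le> F y" and "\<And>y t. F y = ereal t \<Longrightarrow> x \<bullet> y - t \<le> b"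
  shows "fenchel F x \<le> ereal b"
  unfolding fenchel_def
proof (rule SUP_least)
  fix y
  show "ereal (x \<bullet> y) - F y \<le> ereal b"
    using assms(1)[of y] assms(2)[of y] by (cases "F y") auto
qed

lemma fenchel_nonneg:
  assumes "F 0 = 0"
  shows "0 \<le> fenchel F x"
  using fenchel_ge[of F 0 0 x] assms by (simp add: zero_ereal_def)

lemma fenchel_zero:
  assumes "\<And>y. 0 \<le> F y" and "F 0 = 0"
  shows "fenchel F 0 = 0"
proof (rule antisym)
  show "fenchel F 0 \<le> 0"
    unfolding zero_ereal_def
  proof (rule fenchel_le[OF assms(1)])
    fix y t assume "F y = ereal t"
    with assms(1)[of y] show "0 \<bullet> y - t \<le> 0" by simp
  qed
qed (simp add: fenchel_nonneg assms)

lemma fenchel_le_sq: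
  assumes "0 < m" and "\<And>y. ereal (m / 2 * (norm y)\<^sup>2) \<le> F y"
  shows "fenchel F x \<le> ereal (1 / m / 2 * (norm x)\<^sup>2)"
proof (rule fenchel_le)
  show "0 \<le> F y" for y
    using order_trans[OF _ assms(2)[of y], of 0] assms(1) by simp
  fix y t assume "F y = ereal t"
  then have t: "m / 2 * (norm y)\<^sup>2 \<le> t" using assms(2)[of y] by simp
  have "0 \<le> (m * norm y - norm x)\<^sup>2 / m" using assms(1) by simp
  also have "\<dots> = m * (norm y)\<^sup>2 - 2 * (norm x * norm y) + (norm x)\<^sup>2 / m"
    using assms(1) by (simp add: power2_eq_square field_simps)
  finally have "norm x * norm y \<le> m / 2 * (norm y)\<^sup>2 + 1 / m / 2 * (norm x)\<^sup>2"
    by simp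
  with t norm_cauchy_schwarz[of x y] show "x \<bullet> y - t \<le> 1 / m / 2 * (norm x)\<^sup>2"
    by linarith
qed

lemma fenchel_ge_sq:
  assumes "0 < c" and "\<And>y. F y \<le> ereal (c / 2 * (norm y)\<^sup>2)"
  shows "ereal (1 / c / 2 * (norm x)\<^sup>2) \<le> fenchel F x"
proof -
  have "x \<bullet> ((1 / c) *\<^sub>R x) - c / 2 * (norm ((1 / c) *\<^sub>R x))\<^sup>2 = 1 / c / 2 * (norm x)\<^sup>2"
    using assms(1)
    by (simp add: power_mult_distrib power2_norm_eq_inner[symmetric] field_simps power2_eq_square)
  then show ?thesis using fenchel_ge[of F, OF assms(2)[of "(1 / c) *\<^sub>R x"], of x] by simp
qed

lemma convex_ereal_fenchel:
  assumes "\<And>y. 0 \<le> F y"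
  shows "convex_ereal (fenchel F)"
  unfolding convex_ereal_def
proof (intro allI impI)
  fix u v and t :: real assume t: "0 < t \<and> t < 1"
  show "fenchel F ((1 - t) *\<^sub>R u + t *\<^sub>R v) \<le> ereal (1 - t) * fenchel F u + ereal t * fenchel F v"
    unfolding fenchel_def[of F "(1 - t) *\<^sub>R u + t *\<^sub>R v"]
  proof (rule SUP_least)
    fix y
    show "ereal (((1 - t) *\<^sub>R u + t *\<^sub>R v) \<bullet> y) - F y
        \<le> ereal (1 - t) * fenchel F u + ereal t * fenchel F v"
    proof (cases "F y")
      case (real s)
      have "ereal (1 - t) * ereal (u \<bullet> y - s) \<le> ereal (1 - t) * fenchel F u"
        and "ereal t * ereal (v \<bullet> y - s) \<le> ereal t * fenchel F v"
        using t real by (intro ereal_mult_left_mono fenchel_ge; simp)+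
      then have "ereal (1 - t) * ereal (u \<bullet> y - s) + ereal t * ereal (v \<bullet> y - s)
          \<le> ereal (1 - t) * fenchel F u + ereal t * fenchel F v"
        by (rule add_mono)
      then show ?thesis using real by (simp add: inner_add_left algebra_simps)
    qed (use assms[of y] in auto)
  qed
qed

section \<open>Biconjugation\<close>

lemma convex_epigraph:
  assumes "convex_ereal F"
  shows "convex {(x, t). F x \<le> ereal t}"
  unfolding convex_alt
proof (clarsimp)
  fix x y and s t u :: real
  assume x: "F x \<le> ereal s" and y: "F y \<le> ereal t" and u: "0 \<le> u" "u \<le> 1"
  consider "u = 0" | "u = 1" | "0 < u" "u < 1" using u by linarith
  then show "F ((1 - u) *\<^sub>R x + u *\<^sub>R y) \<le> ereal ((1 - u) * s + u * t)"
  proof cases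
    case 3
    then have "F ((1 - u) *\<^sub>R x + u *\<^sub>R y) \<le> ereal (1 - u) * F x + ereal u * F y"
      using assms by (simp add: convex_ereal_def)
    also have "\<dots> \<le> ereal (1 - u) * ereal s + ereal u * ereal t"
      using 3 x y by (intro add_mono ereal_mult_left_mono) auto
    finally show ?thesis by simp
  qed (use x y in auto)
qed

lemma closed_epigraph:
  assumes "lower_semicontinuous F"
  shows "closed {(x, t). F x \<le> ereal t}"
proof -
  have "open (- {(x, t). F x \<le> ereal t})"
  proof (rule Topological_Spaces.openI)
    fix p assume "p \<in> - {(x, t). F x \<le> ereal t}"
    then obtain x s where p: "p = (x, s)" and "ereal s < F x" by (cases p) auto
    then obtain c where c: "ereal s < ereal c" "ereal c < F x"
      using ereal_dense2 by blast
    then have "ereal c < Liminf (at x) F"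
      using assms unfolding lower_semicontinuous_def by (meson less_le_trans)
    then have "eventually (\<lambda>y. ereal c < F y) (at x)"
      by (rule less_LiminfD)
    then obtain U where U: "open U" "x \<in> U" "\<And>y. y \<in> U \<Longrightarrow> y \<noteq> x \<Longrightarrow> ereal c < F y"
      unfolding eventually_at_topological by blast
    have "U \<times> {..<c} \<subseteq> - {(x, t). F x \<le> ereal t}"
    proof clarsimp
      fix y t assume "y \<in> U" "t < c" "F y \<le> ereal t"
      moreover have "ereal c < F y" using U(3)[OF \<open>y \<in> U\<close>] c by (cases "y = x") auto
      ultimately show False by (meson ereal_less_eq(3) leD le_less_trans less_imp_le less_ereal.simps(1))
    qed
    then show "\<exists>T. open T \<and> p \<in> T \<and> T \<subseteq> - {(x, t). F x \<le> ereal t}"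
      using U c p by (intro exI[of _ "U \<times> {..<c}"]) (auto intro: open_Times)
  qed
  then show ?thesis by (simp add: closed_def)
qed

text \<open>
  The Fenchel--Moreau theorem. A point strictly below the graph is separated from the closed convex
  epigraph by a hyperplane. If the hyperplane is not vertical it is the graph of an affine minorant
  of \<open>F\<close>. A vertical one only separates the point from the domain of \<open>F\<close>, but since \<open>F \<ge> 0\<close>
  arbitrarily large multiples of its defining affine function are minorants too.
\<close>
theorem fenchel_fenchel:
  fixes F :: "'a::euclidean_space \<Rightarrow> ereal"
  assumes "F \<in> Cvx0"
  shows "fenchel (fenchel F) = F"
proof
  fix x
  have nn: "\<And>y. 0 \<le> F y" and F0: "F 0 = 0"
    using assms by (auto simp: Cvx0_def)
  show "fenchel (fenchel F) x = F x"
  proof (rule antisym)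
    show "fenchel (fenchel F) x \<le> F x"
    proof (cases "F x")
      case (real t)
      have "fenchel (fenchel F) x \<le> ereal t"
      proof (rule fenchel_le[OF fenchel_nonneg[of F, OF F0]])
        fix y s assume "fenchel F y = ereal s"
        then show "x \<bullet> y - s \<le> t"
          using fenchel_ge[of F x t y] real by (simp add: inner_commute)
      qed
      then show ?thesis using real by simp
    qed (use nn[of x] in auto)
  next
    show "F x \<le> fenchel (fenchel F) x"
    proof (rule ccontr)
      assume "\<not> F x \<le> fenchel (fenchel F) x"
      then obtain c where c: "fenchel (fenchel F) x < ereal c" "ereal c < F x"
        using ereal_dense2[of "fenchel (fenchel F) x" "F x"] by (auto simp: not_le)
      let ?E = "{(y, t). F y \<le> ereal t}"
      have "convex ?E" "closed ?E" "(x, c) \<notin> ?E"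
        using assms c by (auto simp: Cvx0_def intro: convex_epigraph closed_epigraph)
      from separating_hyperplane_closed_point[OF this]
      obtain a b where ab: "a \<bullet> (x, c) < b" "\<forall>e\<in>?E. b < a \<bullet> e" by blast
      obtain p s where a: "a = (p, s)" by (cases a)
      have sep: "p \<bullet> x + s * c < b" "\<And>y t. F y \<le> ereal t \<Longrightarrow> b < p \<bullet> y + s * t"
        using ab a by auto
      have "0 \<le> s"
      proof (rule ccontr)
        assume "\<not> 0 \<le> s"
        then have s: "s < 0" by simp
        define t where "t = max 0 (b / s)"
        have t: "0 \<le> t" "b / s \<le> t" by (auto simp: t_def)
        have "b < s * t" using sep(2)[of 0 t] F0 t by simp
        also have "s * t \<le> s * (b / s)" using s t by (intro mult_left_mono_neg) auto
        finally show False using s by simp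
      qed
      then consider "s = 0" | "0 < s" by linarith
      then have "ereal c \<le> fenchel (fenchel F) x"
      proof cases
        case 1
        then have gap: "0 < b - p \<bullet> x" using sep(1) by simp
        \<comment> \<open>the multiple of the separating function that takes a value \<open>\<ge> c\<close> at \<open>x\<close>\<close>
        define l where "l = \<bar>c\<bar> / (b - p \<bullet> x)"
        have l: "0 \<le> l" "l * (b - p \<bullet> x) = \<bar>c\<bar>" using gap by (auto simp: l_def)
        have conj_le: "fenchel F (- l *\<^sub>R p) \<le> ereal (- l * b)"
        proof (rule fenchel_le[OF nn])
          fix y t assume y: "F y = ereal t"
          then have "b < p \<bullet> y" and "0 \<le> t" using sep(2)[of y t] nn[of y] 1 by auto
          moreover have "l * b \<le> l * (p \<bullet> y)"
            using calculation l by (intro mult_left_mono) auto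
          ultimately show "- l *\<^sub>R p \<bullet> y - t \<le> - l * b" by simp
        qed
        from fenchel_ge[of "fenchel F", OF conj_le, of x]
        have "ereal (l * (b - p \<bullet> x)) \<le> fenchel (fenchel F) x"
          by (simp add: inner_commute algebra_simps)
        moreover have "ereal c \<le> ereal (l * (b - p \<bullet> x))" using l by simp
        ultimately show ?thesis by (rule order_trans[rotated])
      next
        case 2
        \<comment> \<open>the affine minorant of \<open>F\<close> with slope \<open>- p / s\<close>, read as a bound on the transform at its slope\<close>
        have conj_le: "fenchel F ((- 1 / s) *\<^sub>R p) \<le> ereal (- b / s)"
        proof (rule fenchel_le[OF nn])
          fix y t assume "F y = ereal t"
          then have "(b - p \<bullet> y) / s \<le> t"
            using sep(2)[of y t] 2 by (simp add: pos_divide_le_eq mult.commute)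
          then show "(- 1 / s) *\<^sub>R p \<bullet> y - t \<le> - b / s"
            by (simp add: diff_divide_distrib)
        qed
        from fenchel_ge[of "fenchel F", OF conj_le, of x]
        have "ereal ((b - p \<bullet> x) / s) \<le> fenchel (fenchel F) x"
          by (simp add: inner_commute diff_divide_distrib)
        moreover have "c \<le> (b - p \<bullet> x) / s" using sep(1) 2 by (simp add: field_simps)
        ultimately show ?thesis by (meson ereal_less_eq(3) order_trans)
      qed
      then show False using c by simp
    qed
  qed
qed

section \<open>Membership in the cone of functions of quadratic growth\<close>

text \<open>
  Lower semicontinuity comes for free: the quadratic bound makes \<open>g\<close> finite, and a finite convex
  function on a Euclidean space is continuous.
\<close>
lemma K_hI:
  fixes g :: "'a::euclidean_space \<Rightarrow> ereal"
  assumes nn: "\<And>x. 0 \<le> g x" and g0: "g 0 = 0" and cvx: "convex_ereal g"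
    and b: "0 < b" and le: "\<And>x. g x \<le> ereal (b / 2 * (norm x)\<^sup>2)"
  shows "g \<in> K_h"
proof -
  define k where "k x = real_of_ereal (g x)" for x
  have k: "g x = ereal (k x)" for x
    using nn[of x] le[of x] by (cases "g x") (auto simp: k_def)
  have "convex_on UNIV k"
  proof (rule convex_onI)
    fix t :: real and x y assume "0 < t" "t < 1"
    then have "g ((1 - t) *\<^sub>R x + t *\<^sub>R y) \<le> ereal (1 - t) * g x + ereal t * g y"
      using cvx by (simp add: convex_ereal_def)
    then show "k ((1 - t) *\<^sub>R x + t *\<^sub>R y) \<le> (1 - t) * k x + t * k y"
      by (simp add: k)
  qed simp
  then have "continuous_on UNIV k"
    by (rule convex_on_continuous[OF open_UNIV])
  then have "isCont k x" for x
    by (simp add: continuous_on_eq_continuous_at)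
  then have lim: "(g \<longlongrightarrow> g x) (at x)" for x
    unfolding k[abs_def] isCont_def by (simp add: tendsto_ereal k)
  have "lower_semicontinuous g"
    unfolding lower_semicontinuous_def
    using lim_imp_Liminf[OF at_neq_bot lim] by simp
  moreover have "\<forall>x. g x \<le> ereal (b * half_sq x)"
    using le by (simp add: half_sq_def)
  ultimately show ?thesis
    using nn g0 cvx b by (auto simp: K_h_def Cvx0_def)
qed

lemma Cvx0_add:
  fixes f g :: "'a::euclidean_space \<Rightarrow> ereal"
  assumes "f \<in> Cvx0" and "g \<in> Cvx0"
  shows "(\<lambda>x. f x + g x) \<in> Cvx0"
proof -
  have "convex_ereal (\<lambda>x. f x + g x)"
    unfolding convex_ereal_def
  proof (intro allI impI)
    fix x y :: 'a and t :: real assume t: "0 < t \<and> t < 1"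
    let ?z = "(1 - t) *\<^sub>R x + t *\<^sub>R y"
    have "f ?z + g ?z \<le> (ereal (1 - t) * f x + ereal t * f y) + (ereal (1 - t) * g x + ereal t * g y)"
      using assms t by (intro add_mono) (auto simp: Cvx0_def convex_ereal_def)
    also have "\<dots> = ereal (1 - t) * (f x + g x) + ereal t * (f y + g y)"
      using assms by (simp add: Cvx0_def ereal_pos_distrib ereal_right_distrib ac_simps)
    finally show "f ?z + g ?z \<le> ereal (1 - t) * (f x + g x) + ereal t * (f y + g y)" .
  qed
  moreover have "lower_semicontinuous (\<lambda>x. f x + g x)"
    unfolding lower_semicontinuous_def
  proof
    fix x
    have "f x + g x \<le> Liminf (at x) f + Liminf (at x) g"
      using assms by (intro add_mono) (auto simp: Cvx0_def lower_semicontinuous_def)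
    also have "\<dots> \<le> Liminf (at x) (\<lambda>x. f x + g x)"
      by (rule Liminf_add_le) (use assms in \<open>auto simp: Cvx0_def\<close>)
    finally show "f x + g x \<le> Liminf (at x) (\<lambda>x. f x + g x)" .
  qed
  ultimately show ?thesis using assms by (auto simp: Cvx0_def)
qed

section \<open>Stability of the transform under quadratic perturbations\<close>

text \<open>
  The source of the contraction. The conditions on \<open>k\<close> say that \<open>m t\<^sup>2 - 2 t + w\<close> is positive at
  \<open>t = k\<close> and nondecreasing beyond, so that points \<open>y\<close> with \<open>norm y > k * norm x\<close> contribute
  less than \<open>w / 2 * (norm x)\<^sup>2 \<le> fenchel F x\<close> to the supremum. At the remaining points the
  perturbation is at most \<open>e * k\<^sup>2 / 2 * (norm x)\<^sup>2\<close>.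
\<close>
lemma fenchel_perturb:
  assumes m: "0 < m" "\<And>y. ereal (m / 2 * (norm y)\<^sup>2) \<le> F y"
    and F0: "F 0 = 0" and w: "ereal (w / 2 * (norm x)\<^sup>2) \<le> fenchel F x"
    and k: "1 \<le> m * k" "0 < m * k\<^sup>2 - 2 * k + w"
    and e: "0 \<le> e" "\<And>y. G y \<le> F y + ereal (e / 2 * (norm y)\<^sup>2)"
  shows "fenchel F x \<le> fenchel G x + ereal (e * k\<^sup>2 / 2 * (norm x)\<^sup>2)"
proof -
  have nn: "0 \<le> F y" for y
    using order_trans[OF _ m(2)[of y], of 0] m(1) by simp
  have G0: "0 \<le> fenchel G y" for y
    using fenchel_ge[of G 0 0 y] e(2)[of 0] F0 by (simp add: zero_ereal_def)
  show ?thesis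
  proof (cases "x = 0")
    case True
    then show ?thesis using fenchel_zero[of F, OF nn F0] G0[of 0] by simp
  next
    case x: False
    show ?thesis
    proof (cases "fenchel G x")
      case (real b)
      \<comment> \<open>\<open>A\<close> bounds the contribution of the far points, \<open>B\<close> that of the near ones\<close>
      define A where "A = (k - m * k\<^sup>2 / 2) * (norm x)\<^sup>2"
      define B where "B = b + e * k\<^sup>2 / 2 * (norm x)\<^sup>2"
      have "fenchel F x \<le> ereal (max A B)"
      proof (rule fenchel_le[OF nn])
        fix y t assume t: "F y = ereal t"
        show "x \<bullet> y - t \<le> max A B"
        proof (cases "norm y \<le> k * norm x")
          case True
          have "(norm y)\<^sup>2 \<le> (k * norm x)\<^sup>2"
            using True by (intro power_mono) auto
          then have "e / 2 * (norm y)\<^sup>2 \<le> e / 2 * (k * norm x)\<^sup>2"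
            using e(1) by (intro mult_left_mono) auto
          moreover have "ereal (x \<bullet> y - (t + e / 2 * (norm y)\<^sup>2)) \<le> fenchel G x"
            using e(2)[of y] t by (intro fenchel_ge) simp
          ultimately have "x \<bullet> y - t \<le> B"
            using real by (simp add: B_def power_mult_distrib)
          then show ?thesis by simp
        next
          case False
          define d where "d = norm y - k * norm x"
          have d: "0 < d" "norm y = k * norm x + d" using False by (auto simp: d_def)
          have "m / 2 * (norm y)\<^sup>2 - norm x * norm y + A
              = (m * k - 1) * norm x * d + m / 2 * d\<^sup>2"
            unfolding A_def d(2) by (simp add: power2_eq_square algebra_simps)
          moreover have "0 \<le> (m * k - 1) * norm x * d + m / 2 * d\<^sup>2"
            using k(1) m(1) d(1) by simp
          ultimately have "norm x * norm y - m / 2 * (norm y)\<^sup>2 \<le> A" by linarith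
          moreover have "m / 2 * (norm y)\<^sup>2 \<le> t" using m(2)[of y] t by simp
          ultimately show ?thesis using norm_cauchy_schwarz[of x y] by linarith
        qed
      qed
      moreover have "ereal A < fenchel F x"
      proof -
        have "A < w / 2 * (norm x)\<^sup>2"
          unfolding A_def using k(2) x by (intro mult_strict_right_mono) auto
        then show ?thesis using w by (meson less_ereal.simps(1) less_le_trans)
      qed
      ultimately have "fenchel F x \<le> ereal B"
        by (metis leD max_def)
      then show ?thesis using real by (simp add: B_def)
    qed (use G0[of x] in auto)
  qed
qed

text \<open>
  At \<open>k = 1\<close> the quadratic has the value \<open>r + 2 w - 2 > 0\<close>, so a \<open>k\<close> slightly below \<open>1\<close> works.
  The hypotheses also force \<open>r + w > 1\<close>, since otherwise \<open>w > 1\<close> and hence \<open>r < 0\<close>.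
\<close>
lemma contraction_factor:
  fixes r w :: real
  assumes "0 < r" "0 \<le> w" "2 < r + 2 * w"
  obtains k where "0 < k" "k < 1" "1 \<le> (r + w) * k" "0 < (r + w) * k\<^sup>2 - 2 * k + w"
proof -
  define m where "m = r + w"
  have m: "1 < m" "2 < m + w"
    using assms by (auto simp: m_def)
  \<comment> \<open>\<open>1 - u\<close> is the factor: the first entry keeps the quadratic positive, the second ensures \<open>m * (1 - u) \<ge> 1\<close>\<close>
  define u where "u = min ((m + w - 2) / (2 * (m - 1))) ((m - 1) / m)"
  have u: "0 < u" "u \<le> (m + w - 2) / (2 * (m - 1))" "u \<le> (m - 1) / m"
    using m by (auto simp: u_def)
  have u1: "2 * u * (m - 1) \<le> m + w - 2" and u2: "m * u \<le> m - 1"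
    using u(2,3) m by (auto simp: field_simps)
  have "(m - 1) / m < 1" using m by simp
  then have "u < 1" using u(3) by linarith
  have "m * (1 - u)\<^sup>2 - 2 * (1 - u) + w = (m + w - 2 - 2 * u * (m - 1)) + m * u\<^sup>2"
    by (simp add: power2_eq_square algebra_simps)
  moreover have "0 < m * u\<^sup>2" using m u by simp
  ultimately have "0 < m * (1 - u)\<^sup>2 - 2 * (1 - u) + w" using u1 by linarith
  moreover have "1 \<le> m * (1 - u)" using u2 by (simp add: algebra_simps)
  ultimately show ?thesis
    using that[of "1 - u"] u \<open>u < 1\<close> by (simp add: m_def)
qed

section \<open>The continued fraction\<close>

lemma rho_h_bounds:
  assumes "0 < e" and "\<And>x. g x \<le> k x + ereal (e / 2 * (norm x)\<^sup>2)"
    and "\<And>x. k x \<le> g x + ereal (e / 2 * (norm x)\<^sup>2)"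
  shows "0 \<le> rho_h g k" and "rho_h g k \<le> e"
proof -
  let ?S = "{e. e > 0 \<and> (\<forall>x. g x \<le> k x + ereal (e / 2 * (norm x)\<^sup>2) \<and>
    k x \<le> g x + ereal (e / 2 * (norm x)\<^sup>2))}"
  have "e \<in> ?S" using assms by simp
  then show "0 \<le> rho_h g k" unfolding rho_h_def by (intro cInf_greatest) auto
  show "rho_h g k \<le> e" unfolding rho_h_def
    using \<open>e \<in> ?S\<close> by (intro cInf_lower bdd_belowI[of _ 0]) auto
qed

text \<open>
  The upper bound on \<open>f\<close> is kept out of the setting, because the contraction and the passage to the
  limit are the same whether that bound is finite or infinite.
\<close>
locale quadratic_minorant =
  fixes f :: "'a::euclidean_space \<Rightarrow> ereal" and r :: real
  assumes r_pos: "0 < r" and f_Cvx0: "f \<in> Cvx0"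
    and f_ge: "\<And>x. ereal (r / 2 * (norm x)\<^sup>2) \<le> f x"
begin

definition step :: "('a \<Rightarrow> ereal) \<Rightarrow> 'a \<Rightarrow> ereal" where
  "step g = fenchel (\<lambda>x. f x + g x)"

text \<open>
  Starting from \<open>0\<close> instead of from the first approximant makes the innermost transform of \<open>f\<close>
  an instance of the step.
\<close>
definition Z :: "nat \<Rightarrow> 'a \<Rightarrow> ereal" where
  "Z n = (step ^^ n) (\<lambda>_. 0)"

lemma Z_Suc: "Z (Suc n) = step (Z n)"
  by (simp add: Z_def)

lemma approximant_eq_Z: "approximant (replicate (Suc n) f) = Z (Suc n)"
proof (induction n)
  case 0
  show ?case by (simp add: Z_def step_def)
next
  case (Suc n)
  then show ?case by (simp add: Z_Suc[of "Suc n"] step_def)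
qed

lemma f_nonneg: "0 \<le> f x" and f_zero: "f 0 = 0"
  using f_Cvx0 by (auto simp: Cvx0_def)

lemma sum_ge:
  assumes "\<And>x. ereal (w / 2 * (norm x)\<^sup>2) \<le> g x"
  shows "ereal ((r + w) / 2 * (norm x)\<^sup>2) \<le> f x + g x"
  using add_mono[OF f_ge[of x] assms[of x]] by (simp add: algebra_simps add_divide_distrib)

lemma step_le:
  assumes "0 \<le> w" "\<And>x. ereal (w / 2 * (norm x)\<^sup>2) \<le> g x"
  shows "step g x \<le> ereal (1 / (r + w) / 2 * (norm x)\<^sup>2)"
  unfolding step_def using r_pos assms(1) sum_ge[OF assms(2)] by (intro fenchel_le_sq) auto

lemma step_le_nonneg:
  assumes "\<And>x. 0 \<le> g x"
  shows "step g x \<le> ereal (1 / r / 2 * (norm x)\<^sup>2)"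
  using step_le[of 0 g x] assms by (simp add: zero_ereal_def)

lemma step_K_h:
  assumes "\<And>x. 0 \<le> g x" "g 0 = 0"
  shows "step g \<in> K_h"
proof (rule K_hI)
  show "0 \<le> step g x" for x
    unfolding step_def by (rule fenchel_nonneg) (simp add: f_zero assms)
  show "step g 0 = 0"
    unfolding step_def by (rule fenchel_zero) (auto simp: f_zero f_nonneg assms)
  show "convex_ereal (step g)"
    unfolding step_def by (rule convex_ereal_fenchel) (auto simp: f_nonneg assms)
  show "0 < 1 / r" using r_pos by simp
  show "step g x \<le> ereal (1 / r / 2 * (norm x)\<^sup>2)" for x
    using step_le_nonneg assms by blast
qed

text \<open>
  For \<open>v = w\<close> this is the contraction estimate; for \<open>v = w = 0\<close> it is a crude Lipschitz bound that is
  available without a positive lower bound on \<open>step g\<close>.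
\<close>
lemma step_perturb:
  assumes w: "0 \<le> w" "\<And>x. ereal (w / 2 * (norm x)\<^sup>2) \<le> g x" and "g 0 = 0"
    and "\<And>x. ereal (v / 2 * (norm x)\<^sup>2) \<le> step g x"
    and "1 \<le> (r + w) * k" "0 < (r + w) * k\<^sup>2 - 2 * k + v"
    and "0 \<le> e" "\<And>x. g' x \<le> g x + ereal (e / 2 * (norm x)\<^sup>2)"
  shows "step g x \<le> step g' x + ereal (e * k\<^sup>2 / 2 * (norm x)\<^sup>2)"
  unfolding step_def
proof (rule fenchel_perturb)
  show "0 < r + w" using r_pos w(1) by simp
  show "f 0 + g 0 = 0" by (simp add: f_zero assms)
  show "f y + g' y \<le> f y + g y + ereal (e / 2 * (norm y)\<^sup>2)" for y
    using add_left_mono[OF assms(8)[of y], of "f y"] by (simp add: ac_simps)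
qed (use assms sum_ge[OF w(2)] in \<open>auto simp: step_def\<close>)

lemma Z_nonneg: "0 \<le> Z n x" and Z_zero: "Z n 0 = 0"
proof -
  have "(\<forall>x. 0 \<le> Z n x) \<and> Z n 0 = 0"
  proof (induction n)
    case 0
    show ?case by (simp add: Z_def)
  next
    case (Suc n)
    then have "step (Z n) \<in> K_h" by (intro step_K_h) auto
    then show ?case by (auto simp: Z_Suc K_h_def Cvx0_def)
  qed
  then show "0 \<le> Z n x" "Z n 0 = 0" by auto
qed

lemma Z_K_h: "Z (Suc n) \<in> K_h"
  unfolding Z_Suc by (rule step_K_h) (auto simp: Z_nonneg Z_zero)

lemma Z_Suc_le: "Z (Suc n) x \<le> ereal (1 / r / 2 * (norm x)\<^sup>2)"
  unfolding Z_Suc using step_le_nonneg Z_nonneg by blast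

subsection \<open>Reaching the contracting region\<close>

text \<open>
  The transform reverses the order, so one step turns the minorant of \<open>Z n\<close> into a majorant, and the
  next step turns that majorant, added to the one of \<open>f\<close>, into a minorant again.
\<close>
lemma Z_improve_minorant:
  assumes R: "0 < R" "\<And>x. f x \<le> ereal (R / 2 * (norm x)\<^sup>2)"
    and w: "0 \<le> w" "\<And>x. ereal (w / 2 * (norm x)\<^sup>2) \<le> Z n x"
  shows "ereal (1 / (R + 1 / (r + w)) / 2 * (norm x)\<^sup>2) \<le> Z (Suc (Suc n)) x"
  unfolding Z_Suc[of "Suc n"] step_def
proof (rule fenchel_ge_sq)
  show "0 < R + 1 / (r + w)" using R r_pos w by (simp add: add_pos_nonneg)
  have "Z (Suc n) y \<le> ereal (1 / (r + w) / 2 * (norm y)\<^sup>2)" for y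
    unfolding Z_Suc by (rule step_le[OF w])
  from add_mono[OF R(2) this]
  show "f y + Z (Suc n) y \<le> ereal ((R + 1 / (r + w)) / 2 * (norm y)\<^sup>2)" for y
    by (simp add: add_divide_distrib distrib_right)
qed

text \<open>
  Starting from \<open>w = 0\<close>, the minorant is improved until it enters the contracting region. If that never
  happened, \<open>w\<close> would grow by \<open>d > 0\<close> forever, while \<open>r + 2 * w \<le> 2\<close> keeps it at most \<open>1\<close>.
\<close>
lemma Z_eventually_ge:
  assumes R: "0 < R" "\<And>x. f x \<le> ereal (R / 2 * (norm x)\<^sup>2)" and "r\<^sup>2 + 4 * r / R > 4"
  shows "\<exists>w N. 0 \<le> w \<and> 2 < r + 2 * w \<and> (\<forall>n\<ge>N. \<forall>x. ereal (w / 2 * (norm x)\<^sup>2) \<le> Z n x)"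
proof -
  define P where "P w \<longleftrightarrow> 0 \<le> w \<and> (\<exists>N. \<forall>n\<ge>N. \<forall>x. ereal (w / 2 * (norm x)\<^sup>2) \<le> Z n x)" for w
  \<comment> \<open>a lower bound for the gain of two steps, uniform over all \<open>w\<close> below the threshold\<close>
  define d where "d = (r / R + r\<^sup>2 / 4 - 1) / (1 + r / 2 + 1 / R)"
  have d: "0 < d"
    unfolding d_def using assms r_pos by (intro divide_pos_pos add_pos_pos) auto
  have next_P: "P (1 / (R + 1 / (r + w)))" if "P w" for w
  proof -
    obtain N where "0 \<le> w" and N: "\<And>n x. N \<le> n \<Longrightarrow> ereal (w / 2 * (norm x)\<^sup>2) \<le> Z n x"
      using \<open>P w\<close> unfolding P_def by blast
    have "ereal (1 / (R + 1 / (r + w)) / 2 * (norm x)\<^sup>2) \<le> Z n x" if "Suc (Suc N) \<le> n" for n x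
    proof -
      obtain n' where "n = Suc (Suc n')" "N \<le> n'"
        using \<open>Suc (Suc N) \<le> n\<close> by (metis Suc_le_D Suc_le_mono)
      then show ?thesis using Z_improve_minorant[OF R \<open>0 \<le> w\<close> N] by blast
    qed
    then show ?thesis using \<open>0 \<le> w\<close> R r_pos by (auto simp: P_def)
  qed
  have gain: "w + d \<le> 1 / (R + 1 / (r + w))" if w: "0 \<le> w" "r + 2 * w \<le> 2" for w
  proof -
    have m: "0 < r + w" using w r_pos by simp
    have eq: "1 / (R + 1 / (r + w)) - w = (r / R - r * w - w\<^sup>2) / (r + w + 1 / R)"
    proof -
      have "0 < R * (r + w) + 1" using R m by (simp add: add_pos_pos)
      then show ?thesis using R m by (simp add: divide_simps power2_eq_square) (simp add: algebra_simps)
    qed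
    have "(w + r / 2)\<^sup>2 \<le> 1\<^sup>2" using w r_pos by (intro power_mono) auto
    then have "r / R + r\<^sup>2 / 4 - 1 \<le> r / R - r * w - w\<^sup>2"
      by (simp add: power2_eq_square algebra_simps)
    moreover have "0 \<le> r / R + r\<^sup>2 / 4 - 1" using assms(3) by simp
    ultimately have "d \<le> (r / R - r * w - w\<^sup>2) / (r + w + 1 / R)"
      unfolding d_def using w m R by (intro frac_le) (auto simp: add_pos_pos)
    then show ?thesis using eq by linarith
  qed
  have "\<exists>w. P w \<and> (2 < r + 2 * w \<or> real j * d \<le> w)" for j
  proof (induction j)
    case 0
    have "P 0" by (auto simp: P_def Z_nonneg simp flip: zero_ereal_def)
    then show ?case by auto
  next
    case (Suc j)
    then obtain w where w: "P w" "2 < r + 2 * w \<or> real j * d \<le> w" by blast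
    show ?case
    proof (cases "2 < r + 2 * w")
      case False
      then have "w + d \<le> 1 / (R + 1 / (r + w))" using gain w(1) by (auto simp: P_def)
      then have "real (Suc j) * d \<le> 1 / (R + 1 / (r + w))"
        using False w(2) by (simp add: algebra_simps)
      then show ?thesis using next_P[OF w(1)] by blast
    qed (use w in blast)
  qed
  moreover obtain j where "1 < real j * d"
    using reals_Archimedean3[OF d] by blast
  ultimately obtain w where w: "P w" "2 < r + 2 * w \<or> 1 < w"
    by (meson less_le_trans)
  then have "2 < r + 2 * w" using r_pos by auto
  with w(1) show ?thesis unfolding P_def by blast
qed

subsection \<open>Convergence\<close>

text \<open>
  Comparing two arbitrary late iterates, rather than consecutive ones, gives the Cauchy property
  without summing a geometric series; the initial distance is controlled by \<open>0 \<le> Z n \<le> h / r\<close>.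
\<close>
lemma Z_contract:
  assumes w: "0 \<le> w" "\<And>n x. N \<le> n \<Longrightarrow> ereal (w / 2 * (norm x)\<^sup>2) \<le> Z n x"
    and N: "1 \<le> N" and k: "1 \<le> (r + w) * k" "0 < (r + w) * k\<^sup>2 - 2 * k + w"
    and "N + j \<le> n" "N + j \<le> m"
  shows "Z n x \<le> Z m x + ereal ((k\<^sup>2) ^ j / r / 2 * (norm x)\<^sup>2)"
  using assms(6,7)
proof (induction j arbitrary: n m x)
  case 0
  then obtain n' where "n = Suc n'" using N by (cases n) auto
  then have "Z n x \<le> 0 + ereal (1 / r / 2 * (norm x)\<^sup>2)" using Z_Suc_le by simp
  also have "\<dots> \<le> Z m x + ereal (1 / r / 2 * (norm x)\<^sup>2)"
    by (intro add_right_mono Z_nonneg)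
  finally show ?case by simp
next
  case (Suc j)
  then obtain n' m' where nm: "n = Suc n'" "m = Suc m'" "N + j \<le> n'" "N + j \<le> m'"
    by (metis add_Suc_right Suc_le_D Suc_le_mono)
  have "step (Z n') x \<le> step (Z m') x + ereal ((k\<^sup>2) ^ j / r * k\<^sup>2 / 2 * (norm x)\<^sup>2)"
  proof (rule step_perturb)
    show "ereal (w / 2 * (norm x)\<^sup>2) \<le> Z n' x" for x using w(2) nm by simp
    show "ereal (w / 2 * (norm x)\<^sup>2) \<le> step (Z n') x" for x
      using w(2)[of "Suc n'"] nm by (simp add: Z_Suc)
    show "Z m' x \<le> Z n' x + ereal ((k\<^sup>2) ^ j / r / 2 * (norm x)\<^sup>2)" for x
      using Suc.IH nm by blast
  qed (use w k r_pos Z_zero in auto)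
  then show ?case by (simp add: nm Z_Suc mult.commute)
qed

text \<open>
  The contraction gives a limit \<open>z\<close> with \<open>Z n\<close> within \<open>c j\<close> of it for \<open>n \<ge> M + j\<close>. That \<open>z\<close> is a fixed
  point follows by passing to the limit in \<open>Z (Suc n) = step (Z n)\<close>, and biconjugation then yields
  the equation for \<open>fenchel z\<close>.
\<close>
theorem Z_converges:
  assumes w: "0 \<le> w" "2 < r + 2 * w"
    and minorant: "\<And>n x. N \<le> n \<Longrightarrow> ereal (w / 2 * (norm x)\<^sup>2) \<le> Z n x"
  shows "\<exists>z\<in>K_h. (\<lambda>n. rho_h (Z n) z) \<longlonglongrightarrow> 0 \<and> fenchel z = (\<lambda>x. z x + f x)"
proof -
  obtain k where k: "0 < k" "k < 1" "1 \<le> (r + w) * k" "0 < (r + w) * k\<^sup>2 - 2 * k + w"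
    using contraction_factor[OF r_pos w] by blast
  \<comment> \<open>the index is at least \<open>1\<close>, so that the iterates are finite and at most \<open>h / r\<close>\<close>
  define M where "M = Suc N"
  define c where "c j = (k\<^sup>2) ^ j / r" for j
  have c_pos: "0 < c j" for j using k r_pos by (simp add: c_def)
  have "k\<^sup>2 < 1" using k by (simp add: power_less_one_iff)
  then have c_lim: "c \<longlonglongrightarrow> 0"
    unfolding c_def using k r_pos by (intro tendsto_divide_zero LIMSEQ_power_zero) auto
  have close: "Z n x \<le> Z m x + ereal (c j / 2 * (norm x)\<^sup>2)" if "M + j \<le> n" "M + j \<le> m" for n m j x
    unfolding c_def using that k w minorant by (intro Z_contract[of w M k]) (auto simp: M_def)
  define a where "a n x = real_of_ereal (Z n x)" for n x
  have a: "Z n x = ereal (a n x)" if "M \<le> n" for n x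
  proof -
    have "n = Suc (n - 1)" using that by (simp add: M_def)
    then show ?thesis using Z_nonneg[of n x] Z_Suc_le[of "n - 1" x]
      by (cases "Z n x") (auto simp: a_def)
  qed
  have a_close: "a n x \<le> a m x + c j / 2 * (norm x)\<^sup>2" if "M + j \<le> n" "M + j \<le> m" for n m j x
    using close[OF that, of x] that by (simp add: a)
  have cx_lim: "(\<lambda>j. c j / 2 * C) \<longlonglongrightarrow> 0" for C
    using tendsto_mult_left_zero[OF tendsto_divide_zero[OF c_lim]] by blast
  have "Cauchy (\<lambda>n. a n x)" for x
  proof (rule metric_CauchyI)
    fix e :: real assume "0 < e"
    then have "eventually (\<lambda>j. c j / 2 * (norm x)\<^sup>2 < e) sequentially"
      using order_tendstoD(2)[OF cx_lim] by blast
    then obtain j where j: "c j / 2 * (norm x)\<^sup>2 < e"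
      by (auto simp: eventually_sequentially)
    have "dist (a m x) (a n x) < e" if "M + j \<le> m" "M + j \<le> n" for m n
      using a_close[of j m n x] a_close[of j n m x] that j by (simp add: dist_real_def abs_less_iff)
    then show "\<exists>K. \<forall>m\<ge>K. \<forall>n\<ge>K. dist (a m x) (a n x) < e" by blast
  qed
  then have "\<exists>l. (\<lambda>n. a n x) \<longlonglongrightarrow> l" for x
    using Cauchy_convergent_iff convergent_def by blast
  then obtain l where l: "\<And>x. (\<lambda>n. a n x) \<longlonglongrightarrow> l x" by metis
  have l_close: "l x \<le> a n x + c j / 2 * (norm x)\<^sup>2" "a n x \<le> l x + c j / 2 * (norm x)\<^sup>2"
    if "M + j \<le> n" for n j x
  proof -
    show "l x \<le> a n x + c j / 2 * (norm x)\<^sup>2"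
      by (rule LIMSEQ_le_const2[OF l]) (use a_close that in blast)
    have "a n x - c j / 2 * (norm x)\<^sup>2 \<le> l x"
      by (rule LIMSEQ_le_const[OF l], rule exI[of _ "M + j"]) (use a_close[OF that] in \<open>auto simp: algebra_simps\<close>)
    then show "a n x \<le> l x + c j / 2 * (norm x)\<^sup>2" by simp
  qed
  define z where "z x = ereal (l x)" for x
  have z_close: "z x \<le> Z n x + ereal (c j / 2 * (norm x)\<^sup>2)" "Z n x \<le> z x + ereal (c j / 2 * (norm x)\<^sup>2)"
    if "M + j \<le> n" for n j x
    using l_close[OF that, of x] that by (auto simp: a z_def)
  have l0: "l 0 = 0"
    using l[of 0] by (simp add: a_def Z_zero LIMSEQ_const_iff)
  have l_nonneg: "0 \<le> l x" for x
    by (rule LIMSEQ_le_const[OF l]) (auto simp: a_def Z_nonneg real_of_ereal_pos)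
  have a_le: "a n x \<le> 1 / r / 2 * (norm x)\<^sup>2" if "M \<le> n" for n x
    using Z_Suc_le[of "n - 1" x] a[OF that, of x] that by (simp add: M_def)
  have z_K: "z \<in> K_h"
  proof (rule K_hI)
    show "0 < 1 / r" using r_pos by simp
    show "z x \<le> ereal (1 / r / 2 * (norm x)\<^sup>2)" for x
      unfolding z_def ereal_less_eq by (rule LIMSEQ_le_const2[OF l]) (use a_le in blast)
    show "convex_ereal z"
      unfolding convex_ereal_def
    proof (intro allI impI)
      fix x y :: 'a and t :: real assume t: "0 < t \<and> t < 1"
      let ?u = "(1 - t) *\<^sub>R x + t *\<^sub>R y"
      have "a n ?u \<le> (1 - t) * a n x + t * a n y" if "M \<le> n" for n
      proof -
        have "Z n \<in> K_h" using that Z_K_h[of "n - 1"] by (simp add: M_def)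
        then have "Z n ?u \<le> ereal (1 - t) * Z n x + ereal t * Z n y"
          using t by (simp add: K_h_def Cvx0_def convex_ereal_def)
        then show ?thesis using that by (simp add: a)
      qed
      moreover have "(\<lambda>n. (1 - t) * a n x + t * a n y) \<longlonglongrightarrow> (1 - t) * l x + t * l y"
        by (intro tendsto_intros l)
      ultimately have "l ?u \<le> (1 - t) * l x + t * l y"
        using LIMSEQ_le[OF l[of ?u]] by blast
      then show "z ?u \<le> ereal (1 - t) * z x + ereal t * z y" by (simp add: z_def)
    qed
  qed (auto simp: z_def l0 l_nonneg)
  have z_fix: "step z = z"
  proof
    fix x
    have "step z \<in> K_h" by (rule step_K_h) (auto simp: z_def l0 l_nonneg)
    then have s_nonneg: "0 \<le> step z y" for y by (simp add: K_h_def Cvx0_def)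
    moreover have "step z x \<le> ereal (1 / r / 2 * (norm x)\<^sup>2)"
      by (rule step_le_nonneg) (simp add: z_def l_nonneg)
    ultimately obtain s where s: "step z x = ereal s" by (cases "step z x") auto
    \<comment> \<open>the value \<open>3 / r\<close> is admissible as a factor for \<open>v = w = 0\<close>: any number above \<open>2 / r\<close> is\<close>
    have lip: "step g x \<le> step g' x + ereal (e * (3 / r)\<^sup>2 / 2 * (norm x)\<^sup>2)"
      if "\<And>y. 0 \<le> g y" "g 0 = 0" "\<And>y. g' y \<le> g y + ereal (e / 2 * (norm y)\<^sup>2)" "0 \<le> e" for g g' e
    proof (rule step_perturb[where w = 0 and v = 0])
      have "step g \<in> K_h" using that by (intro step_K_h)
      then show "ereal (0 / 2 * (norm y)\<^sup>2) \<le> step g y" for y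
        by (simp add: K_h_def Cvx0_def flip: zero_ereal_def)
      show "0 < (r + 0) * (3 / r)\<^sup>2 - 2 * (3 / r) + 0"
        using r_pos by (simp add: power2_eq_square)
    qed (use that r_pos in \<open>auto simp flip: zero_ereal_def\<close>)
    have "\<bar>l x - s\<bar> \<le> c j / 2 * (((3 / r)\<^sup>2 + 1) * (norm x)\<^sup>2)" for j
    proof -
      let ?n = "M + j"
      have "step z x \<le> Z (Suc ?n) x + ereal (c j * (3 / r)\<^sup>2 / 2 * (norm x)\<^sup>2)"
        unfolding Z_Suc
        by (rule lip) (use z_close[of j ?n] c_pos[of j] in \<open>auto simp: z_def l0 l_nonneg\<close>)
      moreover have "Z (Suc ?n) x \<le> step z x + ereal (c j * (3 / r)\<^sup>2 / 2 * (norm x)\<^sup>2)"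
        unfolding Z_Suc
        by (rule lip) (use z_close[of j ?n] c_pos[of j] in \<open>auto simp: Z_nonneg Z_zero\<close>)
      ultimately have "s \<le> a (Suc ?n) x + c j * (3 / r)\<^sup>2 / 2 * (norm x)\<^sup>2"
        and "a (Suc ?n) x \<le> s + c j * (3 / r)\<^sup>2 / 2 * (norm x)\<^sup>2"
        by (simp_all add: s a)
      then have "\<bar>a (Suc ?n) x - s\<bar> \<le> c j * (3 / r)\<^sup>2 / 2 * (norm x)\<^sup>2"
        by linarith
      moreover have "\<bar>l x - a (Suc ?n) x\<bar> \<le> c j / 2 * (norm x)\<^sup>2"
        using l_close[of j "Suc ?n" x] unfolding abs_le_iff by simp
      ultimately have "\<bar>l x - s\<bar> \<le> c j * (3 / r)\<^sup>2 / 2 * (norm x)\<^sup>2 + c j / 2 * (norm x)\<^sup>2" by linarith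
      also have "\<dots> = c j / 2 * (((3 / r)\<^sup>2 + 1) * (norm x)\<^sup>2)" by (simp add: field_simps)
      finally show ?thesis .
    qed
    then have "\<bar>l x - s\<bar> \<le> 0"
      by (intro LIMSEQ_le_const[OF cx_lim]) auto
    then show "step z x = z x" by (simp add: s z_def)
  qed
  have "fenchel z = (\<lambda>x. z x + f x)"
  proof -
    have "(\<lambda>x. f x + z x) \<in> Cvx0" using f_Cvx0 z_K by (intro Cvx0_add) (auto simp: K_h_def)
    then have "fenchel (fenchel (\<lambda>x. f x + z x)) = (\<lambda>x. f x + z x)"
      by (rule fenchel_fenchel)
    moreover have "fenchel (\<lambda>x. f x + z x) = z"
      using z_fix unfolding step_def .
    ultimately show ?thesis
      by (simp only: add.commute)
  qed
  moreover have "(\<lambda>n. rho_h (Z n) z) \<longlonglongrightarrow> 0"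
  proof (rule LIMSEQ_offset[of _ M], rule tendsto_sandwich[OF _ _ tendsto_const c_lim])
    have "0 \<le> rho_h (Z (j + M)) z \<and> rho_h (Z (j + M)) z \<le> c j" for j
      using rho_h_bounds[OF c_pos[of j], of "Z (j + M)" z] z_close[of j "j + M"] by simp
    then show "\<forall>\<^sub>F j in sequentially. 0 \<le> rho_h (Z (j + M)) z"
      and "\<forall>\<^sub>F j in sequentially. rho_h (Z (j + M)) z \<le> c j" by auto
  qed
  ultimately show ?thesis using z_K by blast
qed

end

theorem theorem5p1:
  fixes r :: real and R :: ereal and f :: "real ^ 'd \<Rightarrow> ereal"
  assumes "0 < r" and "ereal r \<le> R"
    and "ereal (r\<^sup>2) + ereal (4 * r) / R > 4"
    and "f \<in> Cvx0"
    and "\<And>x. ereal (r / 2 * (norm x)\<^sup>2) \<le> f x"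
    and "\<And>x. f x \<le> R / 2 * ereal ((norm x)\<^sup>2)"
  shows "(\<forall>n\<ge>1. approximant (replicate n f) \<in> K_h) \<and>
    (\<exists>z\<in>K_h. (\<lambda>n. rho_h (approximant (replicate n f)) z) \<longlonglongrightarrow> 0 \<and>
       fenchel z = (\<lambda>x. z x + f x))"
proof -
  interpret quadratic_minorant f r
    using assms by unfold_locales auto
  have app: "approximant (replicate n f) = Z n" if "1 \<le> n" for n
    using that approximant_eq_Z[of "n - 1"] by simp
  have "\<exists>w N. 0 \<le> w \<and> 2 < r + 2 * w \<and> (\<forall>n\<ge>N. \<forall>x. ereal (w / 2 * (norm x)\<^sup>2) \<le> Z n x)"
  proof (cases R)
    case (real R')
    have R': "0 < R'" using assms(1,2) real by simp
    have f_le: "f x \<le> ereal (R' / 2 * (norm x)\<^sup>2)" for x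
      using assms(6)[of x] real by simp
    have "r\<^sup>2 + 4 * r / R' > 4"
      using assms(3) real R' by simp
    from Z_eventually_ge[OF R' f_le this] show ?thesis .
  next
    case PInf
    then have "2\<^sup>2 < r\<^sup>2" using assms(3) by simp
    then have "2 < r" using assms(1) by (intro power2_less_imp_less[of 2 r]) auto
    then show ?thesis by (intro exI[of _ 0]) (auto simp: Z_nonneg simp flip: zero_ereal_def)
  qed (use assms(2) in auto)
  then obtain w N where w: "0 \<le> w" "2 < r + 2 * w"
    and N: "\<forall>n\<ge>N. \<forall>x. ereal (w / 2 * (norm x)\<^sup>2) \<le> Z n x" by blast
  obtain z where z: "z \<in> K_h" "(\<lambda>n. rho_h (Z n) z) \<longlonglongrightarrow> 0" "fenchel z = (\<lambda>x. z x + f x)"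
    using Z_converges[OF w N[rule_format]] by blast
  have "(\<lambda>n. rho_h (approximant (replicate n f)) z) \<longlonglongrightarrow> 0"
  proof (rule Lim_transform_eventually[OF z(2)])
    show "\<forall>\<^sub>F n in sequentially. rho_h (Z n) z = rho_h (approximant (replicate n f)) z"
      using app by (intro eventually_sequentiallyI[of 1]) simp
  qed
  moreover have "approximant (replicate n f) \<in> K_h" if "1 \<le> n" for n
    using that Z_K_h[of "n - 1"] by (simp add: app)
  ultimately show ?thesis using z by blast
qed

end
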